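(* Let $A,B\in\mathcal{M}_n$ be positive definite (invertible) and $X\in\mathcal{M}_n$. Then for every real $\alpha\geq 1$, every real $\nu$ with $\frac{1-\alpha}{2}\leq\nu\leq\frac{1+\alpha}{2}$, and every unitarily invariant norm $|||\cdot|||$ on $\mathcal{M}_n$, $$\alpha\,|||A^{\nu}XB^{1-\nu}-A^{1-\nu}XB^{\nu}|||\leq |2\nu-1|\,\max\left(\|A^{1-\alpha}\|,\|B^{1-\alpha}\|\right)\,|||A^{\alpha}X-XB^{\alpha}|||,$$ where $\|\cdot\|$ is the operator norm.
   Context: $\mathcal{M}_n$ is the algebra of $n\times n$ complex matrices. A unitarily invariant norm on $\mathcal{M}_n$ is a norm with $|||UXV|||=|||X|||$ for all unitary $U,V$ (equivalently, a symmetric gauge function of the singular values). *)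

theory Defs
  imports "HOL-Analysis.Analysis"
begin

definition cadjoint :: "complex^'n^'m \<Rightarrow> complex^'m^'n" where
  "cadjoint A = (\<chi> i j. cnj (A $ j $ i))"

definition unitary_mat :: "complex^'n^'n \<Rightarrow> bool" where
  "unitary_mat U \<longleftrightarrow> cadjoint U ** U = mat 1 \<and> U ** cadjoint U = mat 1"

text \<open>For Hermitian \<open>A\<close> the form \<open>x\<^sup>* A x\<close> is real, so taking its real part loses nothing.\<close>

definition posdef_mat :: "complex^'n^'n \<Rightarrow> bool" where
  "posdef_mat A \<longleftrightarrow> cadjoint A = A \<and>
     (\<forall>x. x \<noteq> 0 \<longrightarrow> 0 < Re (\<Sum>i\<in>UNIV. cnj (x $ i) * (A *v x) $ i))"

definition rdiag :: "('n \<Rightarrow> real) \<Rightarrow> complex^'n^'n" where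
  "rdiag d = (\<chi> i j. if i = j then complex_of_real (d i) else 0)"

text \<open>
  Functional calculus: if \<open>A = U diag(d) U\<^sup>*\<close> with \<open>U\<close> unitary and all \<open>d i > 0\<close>, then
  \<open>A\<^sup>t = U diag(d\<^sup>t) U\<^sup>*\<close>. The value does not depend on the diagonalisation
  (lemma \<open>mat_powr_eq\<close>). Positive definite matrices have such a diagonalisation by the spectral
  theorem; for all other matrices the value is unspecified.
\<close>

definition mat_powr :: "complex^'n^'n \<Rightarrow> real \<Rightarrow> complex^'n^'n" where
  "mat_powr A t = (THE P. \<exists>U d. unitary_mat U \<and> (\<forall>i. 0 < d i) \<and>
     A = U ** rdiag d ** cadjoint U \<and>
     P = U ** rdiag (\<lambda>i. d i powr t) ** cadjoint U)"

lemma rdiag_mult_left: "(rdiag d ** W) $ i $ j = complex_of_real (d i) * W $ i $ j"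
proof -
  have "(rdiag d ** W) $ i $ j = (\<Sum>k\<in>UNIV. if i = k then complex_of_real (d i) * W $ k $ j else 0)"
    unfolding rdiag_def matrix_matrix_mult_def vec_lambda_beta by (rule sum.cong) auto
  then show ?thesis by simp
qed

lemma rdiag_mult_right: "(W ** rdiag d) $ i $ j = W $ i $ j * complex_of_real (d j)"
proof -
  have "(W ** rdiag d) $ i $ j = (\<Sum>k\<in>UNIV. if k = j then W $ i $ k * complex_of_real (d k) else 0)"
    unfolding rdiag_def matrix_matrix_mult_def vec_lambda_beta by (rule sum.cong) auto
  then show ?thesis by simp
qed

lemma mat_powr_eq:
  assumes U: "unitary_mat U" and d: "\<And>i. 0 < d i" and A: "A = U ** rdiag d ** cadjoint U"
  shows "mat_powr A t = U ** rdiag (\<lambda>i. d i powr t) ** cadjoint U"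
  unfolding mat_powr_def
proof (rule the_equality)
  show "\<exists>V e. unitary_mat V \<and> (\<forall>i. 0 < e i) \<and> A = V ** rdiag e ** cadjoint V \<and>
      U ** rdiag (\<lambda>i. d i powr t) ** cadjoint U = V ** rdiag (\<lambda>i. e i powr t) ** cadjoint V"
    using assms by blast
next
  fix P
  assume "\<exists>V e. unitary_mat V \<and> (\<forall>i. 0 < e i) \<and> A = V ** rdiag e ** cadjoint V \<and>
      P = V ** rdiag (\<lambda>i. e i powr t) ** cadjoint V"
  then obtain V e where V: "unitary_mat V" and AV: "A = V ** rdiag e ** cadjoint V"
    and P: "P = V ** rdiag (\<lambda>i. e i powr t) ** cadjoint V" by blast
  define W where "W = cadjoint V ** U"
  have "cadjoint V ** (U ** rdiag d ** cadjoint U) ** U = cadjoint V ** (V ** rdiag e ** cadjoint V) ** U"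
    using A AV by simp
  then have "W ** rdiag d ** (cadjoint U ** U) = (cadjoint V ** V) ** rdiag e ** W"
    by (simp add: W_def matrix_mul_assoc)
  then have comm: "W ** rdiag d = rdiag e ** W"
    using U V by (simp add: unitary_mat_def)
  have "W $ i $ j * complex_of_real (d j powr t) = complex_of_real (e i powr t) * W $ i $ j" for i j
  proof (cases "W $ i $ j = 0")
    case False
    have "W $ i $ j * complex_of_real (d j) = complex_of_real (e i) * W $ i $ j"
      using comm by (metis rdiag_mult_left rdiag_mult_right)
    with False have "d j = e i" by simp
    then show ?thesis by simp
  qed simp
  then have comm': "W ** rdiag (\<lambda>j. d j powr t) = rdiag (\<lambda>i. e i powr t) ** W"
    by (simp add: vec_eq_iff rdiag_mult_left rdiag_mult_right)
  have "P = V ** rdiag (\<lambda>i. e i powr t) ** cadjoint V ** (U ** cadjoint U)"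
    using P U by (simp add: unitary_mat_def)
  also have "\<dots> = V ** (rdiag (\<lambda>i. e i powr t) ** W) ** cadjoint U"
    by (simp add: W_def matrix_mul_assoc)
  also have "\<dots> = (V ** cadjoint V) ** U ** rdiag (\<lambda>i. d i powr t) ** cadjoint U"
    by (simp add: comm'[symmetric]) (simp add: W_def matrix_mul_assoc)
  finally show "P = U ** rdiag (\<lambda>i. d i powr t) ** cadjoint U"
    using V by (simp add: unitary_mat_def)
qed

text \<open>Homogeneity is over the complex scalars.\<close>

definition unitarily_invariant_norm :: "(complex^'n^'n \<Rightarrow> real) \<Rightarrow> bool" where
  "unitarily_invariant_norm N \<longleftrightarrow>
     (\<forall>X. 0 \<le> N X) \<and> (\<forall>X. N X = 0 \<longleftrightarrow> X = 0) \<and>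
     (\<forall>c X. N (\<chi> i j. c * X $ i $ j) = cmod c * N X) \<and>
     (\<forall>X Y. N (X + Y) \<le> N X + N Y) \<and>
     (\<forall>U V X. unitary_mat U \<longrightarrow> unitary_mat V \<longrightarrow> N (U ** X ** V) = N X)"

text \<open>
  The norm of \<open>complex^'n\<close> is the Euclidean (l2) norm, so this is the spectral norm.
\<close>

definition opnorm :: "complex^'n^'n \<Rightarrow> real" where
  "opnorm A = onorm (\<lambda>x. A *v x)"

end

theory Submission
  imports Defs
begin

text \<open>
  Diagonalise \<open>A\<close> and \<open>B\<close> with eigenvalues \<open>a i\<close> and \<open>b j\<close>, and write \<open>u = ln (a i) - ln (b j)\<close>
  and \<open>p = 2 * \<nu> - 1\<close>. In the two eigenbases both matrices of the inequality are Schur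
  (entrywise) multiples of the same matrix \<open>Z = U\<^sup>* X V\<close>, and by
  \<open>heinz_difference_factorization\<close> the multiplier on the left, times \<open>\<alpha>\<close>, is the one on the
  right times
  \<open>p * a i powr ((1 - \<alpha>) / 2) * b j powr ((1 - \<alpha>) / 2)\<close> and times the quotient
  \<open>(\<alpha> * sinh (p * u / 2)) / (p * sinh (\<alpha> * u / 2))\<close>.
  So it suffices to bound the norm of the Schur multiplications by the powers and by the quotient.

  The powers of the eigenvalues form a product of two diagonal contractions, once divided by the
  maximum of the two operator norms; a real diagonal contraction is an average of two diagonal
  unitaries (\<open>schur_contractive_diagonal\<close>).

  The quotient of hyperbolic sines takes the value \<open>1\<close> at \<open>u = 0\<close>. By Euler's product
  the quotient is a limit of products of factors \<open>(1 + (p v)\<^sup>2) / (1 + (\<alpha> v)\<^sup>2)\<close> with \<open>v\<close>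
  proportional to \<open>u\<close>. Since \<open>\<bar>p\<bar> \<le> \<alpha>\<close>, which is exactly the hypothesis on \<open>\<nu>\<close>, such a factor is
  a convex combination of \<open>1\<close> and \<open>1 / (1 + (\<alpha> v)\<^sup>2)\<close>, and the latter is a product of two
  resolvents \<open>1 / (1 \<plusminus> \<i> \<alpha> v)\<close>. A resolvent is contractive because multiplication by \<open>\<i> v\<close>
  generates a group of isometries, the conjugations with diagonal unitaries
  (\<open>schur_contractive_resolvent\<close>). Contractive Schur multipliers are closed under products,
  convex combinations and limits, so the quotient is contractive
  (\<open>schur_contractive_sinh_ratio\<close>).
\<close>

section \<open>Diagonalization of positive definite matrices\<close>

text \<open>A maximizer of the Rayleigh quotient is an eigenvector: moving it along its
  residual \<open>l *\<^sub>R x - f x\<close>, which stays inside the invariant subspace, would otherwise push the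
  quotient above its maximum.\<close>

lemma self_adjoint_eigenvector_in_subspace:
  fixes f :: "'a::euclidean_space \<Rightarrow> 'a"
  assumes lin: "linear f" and sa: "\<And>x y. x \<bullet> f y = f x \<bullet> y"
    and W: "subspace W" "f ` W \<subseteq> W" and ne: "w \<in> W" "w \<noteq> 0"
  obtains x l where "x \<in> W" "norm x = 1" "f x = l *\<^sub>R x"
proof -
  define S where "S = sphere 0 1 \<inter> W"
  have "compact S"
    unfolding S_def by (intro compact_Int_closed compact_sphere closed_subspace W)
  moreover have "(1 / norm w) *\<^sub>R w \<in> S"
    unfolding S_def using ne W by (auto simp: subspace_scale)
  moreover have "continuous_on S (\<lambda>x. x \<bullet> f x)"
    by (intro continuous_intros linear_continuous_on linear_conv_bounded_linear[THEN iffD1] lin)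
  ultimately obtain x where x: "x \<in> S" and max: "\<And>y. y \<in> S \<Longrightarrow> y \<bullet> f y \<le> x \<bullet> f x"
    using continuous_attains_sup[of S "\<lambda>x. x \<bullet> f x"] by blast
  define l where "l = x \<bullet> f x"
  have nx: "norm x = 1" and xW: "x \<in> W" using x by (auto simp: S_def)
  have le: "y \<bullet> f y \<le> l * (y \<bullet> y)" if "y \<in> W" for y
  proof (cases "y = 0")
    case False
    have "(1 / norm y) *\<^sub>R y \<in> S" unfolding S_def using False that W by (auto simp: subspace_scale)
    then have "((1 / norm y) *\<^sub>R y) \<bullet> f ((1 / norm y) *\<^sub>R y) \<le> l" unfolding l_def by (rule max)
    then have "(y \<bullet> f y) / (norm y)\<^sup>2 \<le> l" by (simp add: linear_scale[OF lin] power2_eq_square)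
    then show ?thesis using False by (simp add: divide_le_eq power2_norm_eq_inner)
  qed (simp add: linear_0[OF lin])
  define z where "z = l *\<^sub>R x - f x"
  define c where "c = l * (z \<bullet> z) - z \<bullet> f z"
  have zW: "z \<in> W" unfolding z_def using W xW by (auto intro!: subspace_diff subspace_scale)
  have xx: "x \<bullet> x = 1" using nx by (simp add: norm_eq_1)
  have ineq: "2 * t * (z \<bullet> z) \<le> t\<^sup>2 * c" for t
  proof -
    have "x - t *\<^sub>R z \<in> W" using W xW zW by (auto intro!: subspace_diff subspace_scale)
    from le[OF this] have "(x - t *\<^sub>R z) \<bullet> (f x - t *\<^sub>R f z) \<le> l * ((x - t *\<^sub>R z) \<bullet> (x - t *\<^sub>R z))"
      by (simp add: linear_diff[OF lin] linear_scale[OF lin])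
    moreover have "(x - t *\<^sub>R z) \<bullet> (f x - t *\<^sub>R f z) = l - 2 * t * (z \<bullet> f x) + t\<^sup>2 * (z \<bullet> f z)"
      by (simp add: inner_diff_left inner_diff_right l_def sa[of x z] inner_commute[of "f x" z]
          power2_eq_square algebra_simps)
    moreover have "(x - t *\<^sub>R z) \<bullet> (x - t *\<^sub>R z) = 1 - 2 * t * (z \<bullet> x) + t\<^sup>2 * (z \<bullet> z)"
      by (simp add: inner_diff_left inner_diff_right xx inner_commute[of x z]
          power2_eq_square algebra_simps)
    ultimately have "l - 2 * t * (z \<bullet> f x) + t\<^sup>2 * (z \<bullet> f z)
        \<le> l * (1 - 2 * t * (z \<bullet> x) + t\<^sup>2 * (z \<bullet> z))" by (simp only:)
    moreover have "z \<bullet> z = l * (z \<bullet> x) - z \<bullet> f x"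
      by (subst (2) z_def) (simp add: inner_diff_right)
    then have "2 * t * (z \<bullet> z) = l * (2 * t * (z \<bullet> x)) - 2 * t * (z \<bullet> f x)"
      by (simp only: right_diff_distrib) (simp only: mult.left_commute)
    ultimately show ?thesis
      by (simp only: c_def right_diff_distrib distrib_left mult.left_commute[of l "t\<^sup>2"])
  qed
  \<comment> \<open>A first-order term cannot be dominated by a second-order one for small \<open>t\<close>; the \<open>t\<close> below
    is small enough, the summand \<open>1\<close> keeping the denominator nonzero.\<close>
  have "z \<bullet> z \<le> 0"
  proof (rule ccontr)
    assume "\<not> z \<bullet> z \<le> 0"
    then have pos: "z \<bullet> z > 0" by (simp only: not_le)
    define t where "t = (z \<bullet> z) / (1 + \<bar>c\<bar>)"
    have t: "t > 0" using pos by (simp add: t_def divide_pos_pos)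
    have "t * c \<le> t * (1 + \<bar>c\<bar>)" using t by (intro mult_left_mono) auto
    also have "\<dots> = z \<bullet> z" by (simp add: t_def add_nonneg_eq_0_iff)
    finally have "t * (t * c) \<le> t * (z \<bullet> z)" using t by simp
    moreover have "2 * (t * (z \<bullet> z)) \<le> t * (t * c)"
      using ineq[of t] by (simp add: power2_eq_square mult.assoc)
    moreover have "0 < t * (z \<bullet> z)" using t pos by (rule mult_pos_pos)
    ultimately show False by linarith
  qed
  then have "z = 0" by (metis inner_gt_zero_iff not_le)
  then show thesis using that[of x l] xW nx by (simp add: z_def)
qed

definition cdot :: "complex^'n \<Rightarrow> complex^'n \<Rightarrow> complex" where
  "cdot x y = (\<Sum>i\<in>UNIV. cnj (x $ i) * y $ i)"

lemma cdot_add_right: "cdot x (y + z) = cdot x y + cdot x z"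
  by (simp add: cdot_def algebra_simps sum.distrib)

lemma cdot_scaleR_right: "cdot x (r *\<^sub>R y) = of_real r * cdot x y"
  by (simp add: cdot_def sum_distrib_left scaleR_conv_of_real[where 'a = complex] mult.left_commute)

lemma cdot_scaleR_left: "cdot (r *\<^sub>R x) y = of_real r * cdot x y"
  by (simp add: cdot_def sum_distrib_left scaleR_conv_of_real[where 'a = complex] mult.assoc)

lemma cdot_cnj: "cnj (cdot x y) = cdot y x"
  by (simp add: cdot_def mult.commute)

lemma Re_cdot: "Re (cdot x y) = x \<bullet> y"
  by (simp add: cdot_def inner_vec_def inner_complex_def)

lemma cdot_self: "cdot x x = of_real (x \<bullet> x)"
proof -
  have "Im (cdot x x) = 0" using cdot_cnj[of x x] by (metis Reals_cnj_iff complex_is_Real_iff)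
  then show ?thesis by (simp add: complex_eq_iff Re_cdot)
qed

lemma cdot_adjoint: "cdot x (A *v y) = cdot (cadjoint A *v x) y"
  by (simp add: cdot_def cadjoint_def matrix_vector_mult_def sum_distrib_left sum_distrib_right
      mult.assoc mult.left_commute) (rule sum.swap)

text \<open>Orthonormal eigenvectors can be added one at a time: fewer than \<open>n\<close> linear conditions
  on \<open>complex^'n\<close> have a common nonzero solution, and the orthogonal complement of eigenvectors
  is invariant under a Hermitian matrix. Subsets of the index type take the place of dimensions,
  so that the induction never leaves \<open>complex^'n\<close>.\<close>

lemma orthonormal_eigenvectors:
  fixes A :: "complex^'n^'n" and I :: "'n set"
  assumes A: "cadjoint A = A"
  shows "\<exists>e d. (\<forall>i\<in>I. \<forall>j\<in>I. cdot (e i) (e j) = (if i = j then 1 else 0)) \<and>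
    (\<forall>i\<in>I. A *v e i = d i *\<^sub>R e i)"
  using finite[of I]
proof (induction I rule: finite_induct)
  case (insert k I)
  then obtain e d where orth: "\<And>i j. i \<in> I \<Longrightarrow> j \<in> I \<Longrightarrow> cdot (e i) (e j) = (if i = j then 1 else 0)"
    and eig: "\<And>i. i \<in> I \<Longrightarrow> A *v e i = d i *\<^sub>R e i" by blast
  define W where "W = {x. \<forall>i\<in>I. cdot (e i) x = 0}"
  define M :: "complex^'n^'n" where "M = (\<chi> i j. if i \<in> I then cnj (e i $ j) else 0)"
  \<comment> \<open>\<open>M\<close> collects the orthogonality conditions; its zero row \<open>k\<close> makes it singular.\<close>
  have "row k M = 0" using insert by (simp add: row_def M_def vec_eq_iff)
  then have "\<not> invertible M" by (simp add: det_zero_row invertible_det_nz)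
  then obtain w where w: "M *v w = 0" "w \<noteq> 0"
    by (auto simp: invertible_left_inverse matrix_left_invertible_ker)
  have "w \<in> W"
  proof -
    have "cdot (e i) w = (M *v w) $ i" if "i \<in> I" for i
      using that by (simp add: cdot_def M_def matrix_vector_mult_def)
    then show ?thesis using w by (simp add: W_def)
  qed
  have sub: "subspace W"
    unfolding W_def subspace_def by (auto simp: cdot_add_right cdot_scaleR_right) (simp add: cdot_def)
  have inv: "(\<lambda>x. A *v x) ` W \<subseteq> W"
    by (auto simp: W_def cdot_adjoint A eig cdot_scaleR_left)
  have sa: "x \<bullet> (A *v y) = (A *v x) \<bullet> y" for x y
    by (simp add: Re_cdot[symmetric] cdot_adjoint A)
  obtain x l where x: "x \<in> W" "norm x = 1" "A *v x = l *\<^sub>R x"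
    using self_adjoint_eigenvector_in_subspace[OF matrix_vector_mul_linear sa sub inv \<open>w \<in> W\<close> w(2)] by metis
  have xx: "cdot x x = 1" using x by (simp add: cdot_self norm_eq_1)
  have ex: "cdot (e i) x = 0" if "i \<in> I" for i using x that by (simp add: W_def)
  have xe: "cdot x (e i) = 0" if "i \<in> I" for i using ex[OF that] cdot_cnj[of "e i" x] by simp
  have "k \<notin> I" by fact
  then show ?case
    using orth eig x xx ex xe
    by (intro exI[of _ "e(k := x)"] exI[of _ "d(k := l)"]) auto
qed simp

lemma posdef_diagonalization:
  fixes A :: "complex^'n^'n"
  assumes "posdef_mat A"
  obtains U d where "unitary_mat U" "\<And>i. 0 < d i" "A = U ** rdiag d ** cadjoint U"
proof -
  have A: "cadjoint A = A" and pos: "\<And>x. x \<noteq> 0 \<Longrightarrow> 0 < Re (cdot x (A *v x))"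
    using assms by (auto simp: posdef_mat_def cdot_def)
  obtain e d where orth: "\<And>i j. cdot (e i) (e j) = (if i = j then 1 else 0)"
    and eig: "\<And>i::'n. A *v e i = d i *\<^sub>R e i"
    using orthonormal_eigenvectors[OF A, of UNIV] by auto
  define U :: "complex^'n^'n" where "U = (\<chi> i j. e j $ i)"
  have 1: "cadjoint U ** U = mat 1"
    using orth by (simp add: vec_eq_iff matrix_matrix_mult_def cadjoint_def U_def mat_def cdot_def)
  then have 2: "U ** cadjoint U = mat 1" by (simp add: matrix_left_right_inverse)
  have "(A ** U) $ i $ j = (A *v e j) $ i" for i j
    by (simp add: matrix_matrix_mult_def matrix_vector_mult_def U_def)
  then have AU: "A ** U = U ** rdiag d"
    by (simp add: vec_eq_iff rdiag_mult_right eig U_def scaleR_conv_of_real[where 'a = complex] mult.commute)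
  have "A = A ** (U ** cadjoint U)" by (simp add: 2)
  also have "\<dots> = U ** rdiag d ** cadjoint U" by (simp add: matrix_mul_assoc AU)
  finally have eq: "A = U ** rdiag d ** cadjoint U" .
  have "0 < d i" for i
  proof -
    have "cdot (e i) (e i) = 1" by (simp add: orth)
    then have ee: "e i \<bullet> e i = 1" by (simp add: cdot_self del: inner_eq_zero_iff)
    then have "e i \<noteq> 0" by auto
    from pos[OF this] show ?thesis using ee by (simp add: Re_cdot eig)
  qed
  with 1 2 eq show thesis by (intro that) (simp_all add: unitary_mat_def)
qed

lemma rdiag_mult_vec: "(rdiag d *v x) $ i = complex_of_real (d i) * x $ i"
proof -
  have "(rdiag d *v x) $ i = (\<Sum>k\<in>UNIV. if i = k then complex_of_real (d i) * x $ k else 0)"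
    unfolding rdiag_def matrix_vector_mult_def vec_lambda_beta by (rule sum.cong) auto
  then show ?thesis by simp
qed

lemma eigenvalue_le_opnorm:
  assumes U: "unitary_mat U"
  shows "\<bar>d i\<bar> \<le> opnorm (U ** rdiag d ** cadjoint U)"
proof -
  let ?A = "U ** rdiag d ** cadjoint U" and ?v = "U *v axis i 1"
  have "?A ** U = U ** rdiag d"
    using U by (simp add: unitary_mat_def matrix_mul_assoc[symmetric])
  then have "?A *v ?v = U *v (rdiag d *v axis i 1)"
    by (metis matrix_vector_mul_assoc)
  also have "rdiag d *v axis i 1 = d i *\<^sub>R axis i 1"
    by (simp add: vec_eq_iff rdiag_mult_vec axis_def scaleR_conv_of_real[where 'a = complex])
  also have "U *v \<dots> = d i *\<^sub>R ?v" by (rule linear_scale[OF matrix_vector_mul_linear])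
  finally have eig: "?A *v ?v = d i *\<^sub>R ?v" .
  have "cadjoint U *v ?v \<noteq> 0"
    using U by (simp add: unitary_mat_def matrix_vector_mul_assoc)
  then have "?v \<noteq> 0" by (metis linear_0 matrix_vector_mul_linear)
  moreover have "norm (?A *v ?v) \<le> opnorm ?A * norm ?v"
    unfolding opnorm_def by (rule onorm) simp
  ultimately show ?thesis by (simp add: eig)
qed

section \<open>Contractive Schur multipliers\<close>

definition schur :: "('n \<Rightarrow> 'n \<Rightarrow> complex) \<Rightarrow> complex^'n^'n \<Rightarrow> complex^'n^'n" where
  "schur \<phi> Z = (\<chi> i j. \<phi> i j * Z $ i $ j)"

lemma schur_schur: "schur \<phi> (schur \<psi> Z) = schur (\<lambda>i j. \<phi> i j * \<psi> i j) Z"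
  by (simp add: schur_def vec_eq_iff)

lemma schur_add: "schur (\<lambda>i j. \<phi> i j + \<psi> i j) Z = schur \<phi> Z + schur \<psi> Z"
  by (simp add: schur_def vec_eq_iff algebra_simps)

lemma schur_one: "schur (\<lambda>i j. 1) Z = Z"
  by (simp add: schur_def vec_eq_iff)

lemma tendsto_schur:
  assumes "\<And>i j. (\<lambda>n. \<phi> n i j) \<longlonglongrightarrow> \<psi> i j"
  shows "(\<lambda>n. schur (\<phi> n) Z) \<longlonglongrightarrow> schur \<psi> Z"
  unfolding schur_def by (intro vec_tendstoI) (auto intro!: tendsto_intros assms)

definition schur_contractive :: "(complex^'n^'n \<Rightarrow> real) \<Rightarrow> ('n \<Rightarrow> 'n \<Rightarrow> complex) \<Rightarrow> bool" where
  "schur_contractive N \<phi> \<longleftrightarrow> (\<forall>Z. N (schur \<phi> Z) \<le> N Z)"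

definition phase :: "('n \<Rightarrow> real) \<Rightarrow> complex^'n^'n" where
  "phase s = (\<chi> i j. if i = j then cis (s i) else 0)"

lemma phase_mult_left: "(phase s ** Z) $ i $ j = cis (s i) * Z $ i $ j"
proof -
  have "(phase s ** Z) $ i $ j = (\<Sum>k\<in>UNIV. if i = k then cis (s i) * Z $ k $ j else 0)"
    unfolding phase_def matrix_matrix_mult_def vec_lambda_beta by (rule sum.cong) auto
  then show ?thesis by simp
qed

lemma phase_mult_right: "(Z ** phase t) $ i $ j = Z $ i $ j * cis (t j)"
proof -
  have "(Z ** phase t) $ i $ j = (\<Sum>k\<in>UNIV. if k = j then Z $ i $ k * cis (t k) else 0)"
    unfolding phase_def matrix_matrix_mult_def vec_lambda_beta by (rule sum.cong) auto
  then show ?thesis by simp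
qed

lemma unitary_phase: "unitary_mat (phase s)"
proof -
  have "cadjoint (phase s) = phase (\<lambda>i. - s i)"
    by (auto simp: cadjoint_def phase_def vec_eq_iff cis_cnj)
  moreover have "phase (\<lambda>i. - s i) ** phase s = mat 1" "phase s ** phase (\<lambda>i. - s i) = mat 1"
    by (simp_all add: vec_eq_iff phase_mult_left) (auto simp: phase_def mat_def cis_mult)
  ultimately show ?thesis by (simp add: unitary_mat_def)
qed

lemma phase_mult_phase: "phase s ** Z ** phase t = schur (\<lambda>i j. cis (s i) * cis (t j)) Z"
  by (simp add: vec_eq_iff phase_mult_left phase_mult_right schur_def mult.left_commute mult.commute)

locale unitarily_invariant =
  fixes N :: "complex^'n^'n \<Rightarrow> real"
  assumes uinv: "unitarily_invariant_norm N"
begin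

lemma norm_triangle: "N (Y + Z) \<le> N Y + N Z"
  and norm_unitary: "unitary_mat U \<Longrightarrow> unitary_mat V \<Longrightarrow> N (U ** Z ** V) = N Z"
  using uinv by (simp_all add: unitarily_invariant_norm_def)

lemma norm_schur_scale: "N (schur (\<lambda>i j. c * \<phi> i j) Z) = cmod c * N (schur \<phi> Z)"
proof -
  have "schur (\<lambda>i j. c * \<phi> i j) Z = (\<chi> i j. c * schur \<phi> Z $ i $ j)"
    by (simp add: schur_def vec_eq_iff)
  then show ?thesis using uinv by (simp add: unitarily_invariant_norm_def)
qed

lemma norm_schur_const: "N (schur (\<lambda>i j. c) Z) = cmod c * N Z"
  using norm_schur_scale[of c "\<lambda>i j. 1"] by (simp add: schur_one)

lemma norm_schur_add: "N (schur (\<lambda>i j. \<phi> i j + \<psi> i j) Z) \<le> N (schur \<phi> Z) + N (schur \<psi> Z)"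
  by (simp add: schur_add norm_triangle)

lemma norm_scaleR: "N (r *\<^sub>R Z) = \<bar>r\<bar> * N Z"
proof -
  have "r *\<^sub>R Z = schur (\<lambda>i j. complex_of_real r) Z"
    by (simp add: schur_def vec_eq_iff) (simp add: scaleR_conv_of_real)
  then show ?thesis by (simp add: norm_schur_const)
qed

text \<open>Convex functions on a finite-dimensional space are continuous.\<close>

lemma continuous_norm: "continuous_on UNIV N"
proof (rule convex_on_continuous)
  have "N ((1 - u) *\<^sub>R x + u *\<^sub>R y) \<le> (1 - u) * N x + u * N y" if "0 < u" "u < 1" for u x y
    using norm_triangle[of "(1 - u) *\<^sub>R x" "u *\<^sub>R y"] that by (simp add: norm_scaleR)
  then show "convex_on UNIV N" by (intro convex_onI) auto
qed simp

lemma tendsto_norm_schur: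
  assumes "\<And>i j. (\<lambda>n. \<phi> n i j) \<longlonglongrightarrow> \<psi> i j"
  shows "(\<lambda>n. N (schur (\<phi> n) Z)) \<longlonglongrightarrow> N (schur \<psi> Z)"
  using continuous_on_tendsto_compose[OF continuous_norm tendsto_schur[OF assms]] by simp

lemma schur_contractive_limit:
  assumes "\<And>i j. (\<lambda>n. \<phi> n i j) \<longlonglongrightarrow> \<psi> i j" and "\<And>n. schur_contractive N (\<phi> n)"
  shows "schur_contractive N \<psi>"
  unfolding schur_contractive_def
proof
  fix Z
  show "N (schur \<psi> Z) \<le> N Z"
    using assms(2) by (intro LIMSEQ_le_const2[OF tendsto_norm_schur[OF assms(1)]])
      (auto simp: schur_contractive_def)
qed

lemma schur_contractive_one: "schur_contractive N (\<lambda>i j. 1)"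
  by (simp add: schur_contractive_def schur_one)

lemma schur_contractive_mult:
  assumes "schur_contractive N \<phi>" "schur_contractive N \<psi>"
  shows "schur_contractive N (\<lambda>i j. \<phi> i j * \<psi> i j)"
  using assms unfolding schur_contractive_def schur_schur[symmetric] by (meson order_trans)

lemma schur_contractive_convex:
  assumes "schur_contractive N \<phi>" "schur_contractive N \<psi>" "0 \<le> r" "r \<le> 1"
  shows "schur_contractive N (\<lambda>i j. of_real r * \<phi> i j + of_real (1 - r) * \<psi> i j)"
  unfolding schur_contractive_def
proof
  fix Z
  have "N (schur (\<lambda>i j. of_real r * \<phi> i j + of_real (1 - r) * \<psi> i j) Z)
      \<le> r * N (schur \<phi> Z) + (1 - r) * N (schur \<psi> Z)"
    using norm_schur_add[of "\<lambda>i j. of_real r * \<phi> i j" "\<lambda>i j. of_real (1 - r) * \<psi> i j" Z] assms(3,4)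
    by (simp only: norm_schur_scale norm_of_real)
  also have "\<dots> \<le> r * N Z + (1 - r) * N Z"
    using assms by (intro add_mono mult_left_mono) (auto simp: schur_contractive_def)
  finally show "N (schur (\<lambda>i j. of_real r * \<phi> i j + of_real (1 - r) * \<psi> i j) Z) \<le> N Z"
    by (simp add: algebra_simps)
qed

lemma norm_schur_phases: "N (schur (\<lambda>i j. cis (s i) * cis (t j)) Z) = N Z"
  unfolding phase_mult_phase[symmetric] by (intro norm_unitary unitary_phase)

text \<open>A real number \<open>x\<close> in \<open>[-1, 1]\<close> is the average of the unit complex numbers
  \<open>cis (\<plusminus> arccos x)\<close>, so a real diagonal contraction is an average of two diagonal unitaries.\<close>

lemma schur_contractive_diagonal:
  assumes c: "\<And>i. \<bar>c i\<bar> \<le> 1" and d: "\<And>j. \<bar>d j\<bar> \<le> 1"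
  shows "schur_contractive N (\<lambda>i j. of_real (c i * d j))"
proof -
  have av: "of_real (1/2) * cis (arccos x) + of_real (1 - 1/2) * cis (- arccos x) = complex_of_real x"
    if "\<bar>x\<bar> \<le> 1" for x :: real
    by (simp add: complex_eq_iff cos_arccos_abs[OF that])
  have "schur_contractive N (\<lambda>i j. cis (s i) * cis (t j))" for s t
    by (simp add: schur_contractive_def norm_schur_phases)
  from this[of _ "\<lambda>_. 0"] this[of "\<lambda>_. 0"]
  have L: "schur_contractive N (\<lambda>i j. cis (s i))" and R: "schur_contractive N (\<lambda>i j. cis (s j))" for s
    by simp_all
  have half: "0 \<le> (1/2 :: real)" "(1/2 :: real) \<le> 1" by simp_all
  have "schur_contractive N (\<lambda>i j. of_real (c i))"
    using schur_contractive_convex[OF L[of "\<lambda>i. arccos (c i)"] L[of "\<lambda>i. - arccos (c i)"] half]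
    by (simp only: av[OF c])
  moreover have "schur_contractive N (\<lambda>i j. of_real (d j))"
    using schur_contractive_convex[OF R[of "\<lambda>i. arccos (d i)"] R[of "\<lambda>i. - arccos (d i)"] half]
    by (simp only: av[OF d])
  ultimately show ?thesis using schur_contractive_mult by fastforce
qed

text \<open>
  Let \<open>G\<close> be the Schur multiplication by \<open>\<i> (s i - t j)\<close>. The isometries \<open>exp (G / m)\<close> satisfy
  \<open>m * exp (G / m) \<approx> (1 + G) + (m - 1)\<close> for large \<open>m\<close>. Applied to \<open>Z\<close>, the triangle inequality gives
  \<open>m * N Z \<le> N ((1 + G) Z) + (m - 1) * N Z\<close> up to an error that vanishes as \<open>m\<close> grows. Hence
  \<open>1 + G\<close> never decreases the norm, and its inverse never increases it.
\<close>

lemma schur_contractive_resolvent: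
  "schur_contractive N (\<lambda>i j. 1 / (1 + \<i> * of_real (s i - t j)))"
proof -
  have nz: "1 + \<i> * complex_of_real u \<noteq> 0" for u
    by (auto simp: complex_eq_iff)
  have expand: "N Z \<le> N (schur (\<lambda>i j. 1 + \<i> * of_real (s i - t j)) Z)" for Z
  proof -
    \<comment> \<open>The error of the approximation, with \<open>m = n + 1\<close>.\<close>
    define \<delta> where "\<delta> = (\<lambda>n i j. 1 + \<i> * of_real (s i - t j) - (of_nat (Suc n) * (cis ((s i - t j) / real (Suc n)) - 1) + 1))"
    let ?Y = "schur (\<lambda>i j. 1 + \<i> * of_real (s i - t j)) Z"
    \<comment> \<open>The limit is the derivative of \<open>exp (\<i> u z)\<close> at \<open>z = 0\<close>, taken along \<open>z = 1 / (n + 1)\<close>.\<close>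
    have lim: "(\<lambda>n. of_nat (Suc n) * (cis (u / real (Suc n)) - 1)) \<longlonglongrightarrow> \<i> * of_real u" for u :: real
    proof -
      define h where "h = (\<lambda>n. 1 / complex_of_nat (Suc n))"
      have "((\<lambda>z. exp (\<i> * of_real u * z)) has_field_derivative \<i> * of_real u) (at 0)"
        by (auto intro!: derivative_eq_intros)
      then have "((\<lambda>z. (exp (\<i> * of_real u * z) - 1) / z) \<longlongrightarrow> \<i> * of_real u) (at 0)"
        by (simp add: DERIV_def)
      moreover have "filterlim h (at 0) sequentially"
        unfolding h_def by (intro filterlim_atI LIMSEQ_Suc lim_1_over_n) (auto simp del: of_nat_Suc)
      ultimately have "(\<lambda>n. (exp (\<i> * of_real u * h n) - 1) / h n) \<longlonglongrightarrow> \<i> * of_real u"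
        by (rule filterlim_compose)
      then show ?thesis by (simp add: h_def cis_conv_exp mult.commute del: of_nat_Suc)
    qed
    have "N Z \<le> N ?Y + N (schur (\<delta> n) Z)" for n
    proof -
      let ?m = "complex_of_nat (Suc n)"
      let ?E = "\<lambda>i j. cis (s i / real (Suc n)) * cis (- t j / real (Suc n))"
      have "schur (\<lambda>i j. ?m * ?E i j) Z =
          (?Y + schur (\<lambda>i j. of_nat n) Z) + schur (\<lambda>i j. (-1) * \<delta> n i j) Z"
        by (simp add: schur_def vec_eq_iff \<delta>_def cis_mult algebra_simps diff_divide_distrib)
      then have "N (schur (\<lambda>i j. ?m * ?E i j) Z)
          \<le> (N ?Y + N (schur (\<lambda>i j. of_nat n) Z)) + N (schur (\<lambda>i j. (-1) * \<delta> n i j) Z)"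
        by (metis (no_types, lifting) norm_triangle order_trans add_right_mono)
      then have "real (Suc n) * N Z \<le> N ?Y + real n * N Z + N (schur (\<delta> n) Z)"
        unfolding norm_schur_scale norm_schur_const norm_of_nat norm_schur_phases
        by simp
      then show ?thesis by (simp add: algebra_simps)
    qed
    moreover have "(\<lambda>n. N ?Y + N (schur (\<delta> n) Z)) \<longlonglongrightarrow> N ?Y + N (schur (\<lambda>i j. 0) Z)"
    proof (intro tendsto_intros tendsto_norm_schur)
      fix i j
      have "(\<lambda>n. \<delta> n i j) \<longlonglongrightarrow> 1 + \<i> * of_real (s i - t j) - (\<i> * of_real (s i - t j) + 1)"
        unfolding \<delta>_def by (intro tendsto_intros lim)
      then show "(\<lambda>n. \<delta> n i j) \<longlonglongrightarrow> 0" by simp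
    qed
    ultimately have "N Z \<le> N ?Y + N (schur (\<lambda>i j. 0) Z)"
      by (intro LIMSEQ_le_const) auto
    then show ?thesis
      using norm_schur_const[of 0 Z] by simp
  qed
  show ?thesis
    unfolding schur_contractive_def
    using expand[of "schur (\<lambda>i j. 1 / (1 + \<i> * of_real (s i - t j))) Z" for Z]
    by (simp add: schur_schur nz schur_one del: of_real_diff)
qed

lemma schur_contractive_lorentz:
  "schur_contractive N (\<lambda>i j. of_real (1 / (1 + (s i - t j)\<^sup>2)))"
proof -
  have eq: "1 / (1 + \<i> * of_real u) * (1 / (1 + \<i> * of_real (- u))) = complex_of_real (1 / (1 + u\<^sup>2))"
    for u
    by (simp add: algebra_simps power2_eq_square)
  have "schur_contractive N (\<lambda>i j. 1 / (1 + \<i> * of_real (- (s i - t j))))"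
    using schur_contractive_resolvent[of "\<lambda>i. - s i" "\<lambda>j. - t j"] by simp
  from schur_contractive_mult[OF schur_contractive_resolvent[of s t] this] show ?thesis
    by (simp only: eq)
qed

lemma schur_contractive_lorentz_ratio:
  assumes "\<bar>p\<bar> \<le> a" "0 < a"
  shows "schur_contractive N (\<lambda>i j. of_real ((1 + (p * (s i - t j))\<^sup>2) / (1 + (a * (s i - t j))\<^sup>2)))"
proof -
  have le: "0 \<le> (p / a)\<^sup>2" "(p / a)\<^sup>2 \<le> 1"
    using assms by (auto simp: abs_square_le_1)
  have eq: "of_real ((p / a)\<^sup>2) * 1 + of_real (1 - (p / a)\<^sup>2) * of_real (1 / (1 + (a * x - a * y)\<^sup>2))
      = complex_of_real ((1 + (p * (x - y))\<^sup>2) / (1 + (a * (x - y))\<^sup>2))" for x y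
  proof -
    have "c\<^sup>2 * 1 + (1 - c\<^sup>2) * (1 / (1 + v\<^sup>2)) = (1 + (c * v)\<^sup>2) / (1 + v\<^sup>2)" for c v :: real
    proof -
      have "1 + v\<^sup>2 \<noteq> 0" by (metis add_eq_0_iff not_one_le_zero le_minus_one_simps(3) zero_le_power2)
      then show ?thesis by (simp add: field_simps)
    qed
    from this[of "p / a" "a * (x - y)"] have
      "(p / a)\<^sup>2 * 1 + (1 - (p / a)\<^sup>2) * (1 / (1 + (a * x - a * y)\<^sup>2)) = (1 + (p * (x - y))\<^sup>2) / (1 + (a * (x - y))\<^sup>2)"
      using assms by (simp add: right_diff_distrib)
    then show ?thesis by (metis of_real_add of_real_mult of_real_1)
  qed
  show ?thesis
    using schur_contractive_convex[OF schur_contractive_one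
      schur_contractive_lorentz[of "\<lambda>i. a * s i" "\<lambda>j. a * t j"] le] by (simp only: eq)
qed

end

section \<open>Quotients of hyperbolic sines\<close>

text \<open>Euler's product for the sine, at an imaginary argument.\<close>

lemma sinh_product_formula:
  fixes x :: real
  shows "(\<lambda>n. pi * x * (\<Prod>k=1..n. 1 + (x / real k)\<^sup>2)) \<longlonglongrightarrow> sinh (pi * x)"
proof -
  have "(\<lambda>n. - \<i> * (of_real pi * (\<i> * of_real x) * (\<Prod>k=1..n. 1 - (\<i> * of_real x)\<^sup>2 / of_nat k^2)))
      \<longlonglongrightarrow> - \<i> * sin (of_real pi * (\<i> * of_real x))"
    by (intro tendsto_intros sin_product_formula_complex)
  also have "(\<lambda>n. - \<i> * (of_real pi * (\<i> * of_real x) * (\<Prod>k=1..n. 1 - (\<i> * of_real x)\<^sup>2 / of_nat k^2)))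
      = (\<lambda>n. complex_of_real (pi * x * (\<Prod>k=1..n. 1 + (x / real k)\<^sup>2)))"
  proof
    fix n
    have "- \<i> * (a * (\<i> * b) * c) = a * b * c" for a b c
      by (simp add: complex_eq_iff algebra_simps)
    moreover have "(\<Prod>k=1..n. 1 - (\<i> * of_real x)\<^sup>2 / of_nat k^2) = complex_of_real (\<Prod>k=1..n. 1 + (x / real k)\<^sup>2)"
      by (simp add: power_mult_distrib power_divide)
    ultimately show "- \<i> * (of_real pi * (\<i> * of_real x) * (\<Prod>k=1..n. 1 - (\<i> * of_real x)\<^sup>2 / of_nat k^2))
      = complex_of_real (pi * x * (\<Prod>k=1..n. 1 + (x / real k)\<^sup>2))"
      by (simp only: of_real_mult)
  qed
  also have "- \<i> * sin (of_real pi * (\<i> * of_real x)) = of_real (sinh (pi * x))"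
    using sinh_conv_sin[of "of_real (pi * x)"]
    by (simp add: sinh_field_def mult.left_commute flip: exp_of_real)
  finally show ?thesis by (simp only: tendsto_of_real_iff)
qed

text \<open>The case distinction makes the function continuous at \<open>u = 0\<close>, where the quotient alone
  would be \<open>0\<close> by the convention \<open>x / 0 = 0\<close>.\<close>

definition sinh_ratio :: "real \<Rightarrow> real \<Rightarrow> real \<Rightarrow> real" where
  "sinh_ratio p a u = (if u = 0 then 1 else a * sinh (p * u) / (p * sinh (a * u)))"

lemma sinh_ratio_product:
  assumes p: "p \<noteq> 0" and a: "0 < a"
  shows "(\<lambda>n. \<Prod>k=1..n. (1 + (p * (u / (pi * real k)))\<^sup>2) / (1 + (a * (u / (pi * real k)))\<^sup>2))
    \<longlonglongrightarrow> sinh_ratio p a u"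
proof (cases "u = 0")
  case False
  have P: "(\<lambda>n. \<Prod>k=1..n. 1 + (q * (u / (pi * real k)))\<^sup>2) \<longlonglongrightarrow> sinh (q * u) / (q * u)" if "q \<noteq> 0" for q
  proof -
    have "(\<lambda>n. (q * u * (\<Prod>k=1..n. 1 + (q * (u / (pi * real k)))\<^sup>2)) / (q * u)) \<longlonglongrightarrow> sinh (q * u) / (q * u)"
      using sinh_product_formula[of "q * u / pi"] that False
      by (intro tendsto_divide tendsto_const) (auto simp: field_simps)
    then show ?thesis using that False by simp
  qed
  have "(\<lambda>n. (\<Prod>k=1..n. 1 + (p * (u / (pi * real k)))\<^sup>2) / (\<Prod>k=1..n. 1 + (a * (u / (pi * real k)))\<^sup>2))
      \<longlonglongrightarrow> (sinh (p * u) / (p * u)) / (sinh (a * u) / (a * u))"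
    using p a False by (intro tendsto_divide P) auto
  then show ?thesis using False by (simp add: sinh_ratio_def prod_dividef mult_ac)
qed (simp add: sinh_ratio_def)

context unitarily_invariant begin

lemma schur_contractive_sinh_ratio:
  assumes p: "p \<noteq> 0" and pa: "\<bar>p\<bar> \<le> a"
  shows "schur_contractive N (\<lambda>i j. of_real (sinh_ratio p a (s i - t j)))"
proof (rule schur_contractive_limit)
  have a: "0 < a" using p pa by linarith
  let ?P = "\<lambda>n i j. \<Prod>k=1..n. (1 + (p * ((s i - t j) / (pi * real k)))\<^sup>2) / (1 + (a * ((s i - t j) / (pi * real k)))\<^sup>2)"
  show "(\<lambda>n. complex_of_real (?P n i j)) \<longlonglongrightarrow> of_real (sinh_ratio p a (s i - t j))" for i j
    by (intro tendsto_of_real sinh_ratio_product p a)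
  show "schur_contractive N (\<lambda>i j. complex_of_real (?P n i j))" for n
  proof (induction n)
    case (Suc n)
    from schur_contractive_mult[OF Suc schur_contractive_lorentz_ratio[OF pa a,
        of "\<lambda>i. s i / (pi * real (Suc n))" "\<lambda>j. t j / (pi * real (Suc n))"]]
    show ?case by (simp only: prod.nat_ivl_Suc' of_real_mult diff_divide_distrib mult.commute)
  qed (simp add: schur_contractive_one)
qed

end

section \<open>The norm inequality\<close>

context unitarily_invariant begin

lemma norm_sandwich:
  assumes "unitary_mat U" "unitary_mat V"
  shows "N (U ** Z ** cadjoint V) = N Z"
proof -
  have "cadjoint (cadjoint V) = V" by (simp add: cadjoint_def vec_eq_iff)
  then have "unitary_mat (cadjoint V)" using assms(2) by (simp add: unitary_mat_def)
  with assms(1) show ?thesis by (rule norm_unitary)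
qed

end

lemma spectral_sandwich:
  "(U ** rdiag c ** cadjoint U) ** X ** (V ** rdiag d ** cadjoint V) =
    U ** schur (\<lambda>i j. of_real (c i * d j)) (cadjoint U ** X ** V) ** cadjoint V"
proof -
  have "rdiag c ** Z ** rdiag d = schur (\<lambda>i j. of_real (c i * d j)) Z" for Z
    by (simp add: vec_eq_iff rdiag_mult_left rdiag_mult_right schur_def mult.left_commute mult.commute)
  from this[of "cadjoint U ** X ** V"] show ?thesis
    by (metis matrix_mul_assoc)
qed

lemma difference_sandwich:
  fixes Z :: "complex^'n^'n"
  shows "U ** schur \<phi> Z ** W - U ** schur \<psi> Z ** W = U ** schur (\<lambda>i j. \<phi> i j - \<psi> i j) Z ** W"
proof -
  have "schur \<phi> Z = schur (\<lambda>i j. \<phi> i j - \<psi> i j) Z + schur \<psi> Z"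
    by (simp flip: schur_add)
  then show ?thesis
    by (simp add: matrix_add_ldistrib)
       (simp add: matrix_matrix_mult_def vec_eq_iff distrib_right sum.distrib)
qed

text \<open>With \<open>s = ln a\<close> and \<open>t = ln b\<close>, the two differences are
  \<open>2 exp ((s + t) / 2) sinh ((2 * \<nu> - 1) (s - t) / 2)\<close> and
  \<open>2 exp (\<alpha> (s + t) / 2) sinh (\<alpha> (s - t) / 2)\<close>.\<close>

lemma heinz_difference_factorization:
  fixes a b \<alpha> \<nu> :: real
  assumes a: "0 < a" and b: "0 < b" and \<alpha>: "0 < \<alpha>" and \<nu>: "2 * \<nu> - 1 \<noteq> 0"
  shows "\<alpha> * (a powr \<nu> * b powr (1 - \<nu>) - a powr (1 - \<nu>) * b powr \<nu>) =
    (2 * \<nu> - 1) * (a powr ((1 - \<alpha>) / 2) * b powr ((1 - \<alpha>) / 2)) *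
      sinh_ratio ((2 * \<nu> - 1) / 2) (\<alpha> / 2) (ln a - ln b) * (a powr \<alpha> - b powr \<alpha>)"
proof (cases "ln a - ln b = 0")
  case True
  then have "a = b" using a b by simp
  then show ?thesis by (simp add: mult.commute)
next
  case False
  define s t where "s = ln a" and "t = ln b"
  define p where "p = 2 * \<nu> - 1"
  have pw: "a powr x = exp (x * s)" "b powr x = exp (x * t)" for x
    using a b by (simp_all add: powr_def s_def t_def)
  have sh: "2 * sinh x = exp x - exp (- x)" for x :: real by (simp add: sinh_field_def)
  have nz: "sinh (\<alpha> / 2 * (s - t)) \<noteq> 0" using False \<alpha> by (simp add: s_def t_def)
  have 1: "a powr \<nu> * b powr (1 - \<nu>) - a powr (1 - \<nu>) * b powr \<nu>
      = exp ((s + t) / 2) * (2 * sinh (p / 2 * (s - t)))"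
    unfolding sh right_diff_distrib pw exp_add[symmetric] p_def
    by (intro arg_cong2[where f = "(-)"] arg_cong[where f = exp]) (simp_all add: field_simps)
  have 2: "a powr \<alpha> - b powr \<alpha> = exp (\<alpha> * (s + t) / 2) * (2 * sinh (\<alpha> / 2 * (s - t)))"
    unfolding sh right_diff_distrib pw exp_add[symmetric]
    by (intro arg_cong2[where f = "(-)"] arg_cong[where f = exp]) (simp_all add: field_simps)
  have 3: "a powr ((1 - \<alpha>) / 2) * b powr ((1 - \<alpha>) / 2) * exp (\<alpha> * (s + t) / 2) = exp ((s + t) / 2)"
    unfolding pw exp_add[symmetric]
    by (intro arg_cong[where f = exp]) (simp add: field_simps)
  have "p * (a powr ((1 - \<alpha>) / 2) * b powr ((1 - \<alpha>) / 2)) *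
      sinh_ratio (p / 2) (\<alpha> / 2) (s - t) * (a powr \<alpha> - b powr \<alpha>)
    = (a powr ((1 - \<alpha>) / 2) * b powr ((1 - \<alpha>) / 2) * exp (\<alpha> * (s + t) / 2)) *
      (p * sinh_ratio (p / 2) (\<alpha> / 2) (s - t) * (2 * sinh (\<alpha> / 2 * (s - t))))"
    unfolding 2 by (simp only: mult_ac)
  also have "\<dots> = exp ((s + t) / 2) * (\<alpha> * (2 * sinh (p / 2 * (s - t))))"
  proof -
    have "p * sinh_ratio (p / 2) (\<alpha> / 2) (s - t) * (2 * sinh (\<alpha> / 2 * (s - t)))
        = \<alpha> * (2 * sinh (p / 2 * (s - t)))"
      using False nz \<nu> by (simp add: sinh_ratio_def s_def t_def p_def)
    then show ?thesis by (simp only: 3)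
  qed
  finally show ?thesis unfolding 1 by (simp add: p_def s_def t_def)
qed

theorem theorem4p5:
  fixes A B X :: "complex^'n^'n"
    and \<alpha> \<nu> :: real
    and N :: "complex^'n^'n \<Rightarrow> real"
  assumes "posdef_mat A"
    and "posdef_mat B"
    and "\<alpha> \<ge> 1"
    and "(1 - \<alpha>) / 2 \<le> \<nu>"
    and "\<nu> \<le> (1 + \<alpha>) / 2"
    and "unitarily_invariant_norm N"
  shows "\<alpha> * N (mat_powr A \<nu> ** X ** mat_powr B (1 - \<nu>) - mat_powr A (1 - \<nu>) ** X ** mat_powr B \<nu>)
    \<le> \<bar>2 * \<nu> - 1\<bar> * max (opnorm (mat_powr A (1 - \<alpha>))) (opnorm (mat_powr B (1 - \<alpha>)))
      * N (mat_powr A \<alpha> ** X - X ** mat_powr B \<alpha>)"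
proof (cases "2 * \<nu> - 1 = 0")
  case True
  have "1 - \<nu> = \<nu>" using True by simp
  moreover have "N 0 = 0" using assms(6) by (simp add: unitarily_invariant_norm_def)
  ultimately show ?thesis
    by (simp only: True diff_self abs_zero mult_zero_left mult_zero_right order_refl)
next
  case False
  interpret unitarily_invariant N by (unfold_locales) (rule assms(6))
  obtain U a where U: "unitary_mat U" and a: "\<And>i. 0 < a i" and A: "A = U ** rdiag a ** cadjoint U"
    using posdef_diagonalization[OF assms(1)] by metis
  obtain V b where V: "unitary_mat V" and b: "\<And>i. 0 < b i" and B: "B = V ** rdiag b ** cadjoint V"
    using posdef_diagonalization[OF assms(2)] by metis
  note powr_A = mat_powr_eq[OF U a A] and powr_B = mat_powr_eq[OF V b B]
  define Z where "Z = cadjoint U ** X ** V"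
  define m where "m = max (opnorm (mat_powr A (1 - \<alpha>))) (opnorm (mat_powr B (1 - \<alpha>)))"
  define h where "h i j = a i powr \<nu> * b j powr (1 - \<nu>) - a i powr (1 - \<nu>) * b j powr \<nu>" for i j
  define k where "k i j = a i powr \<alpha> - b j powr \<alpha>" for i j
  define c where "c i = a i powr ((1 - \<alpha>) / 2) / sqrt m" for i
  define d where "d j = b j powr ((1 - \<alpha>) / 2) / sqrt m" for j
  define g where "g i j = sinh_ratio ((2 * \<nu> - 1) / 2) (\<alpha> / 2) (ln (a i) - ln (b j))" for i j

  have lhs: "N (mat_powr A \<nu> ** X ** mat_powr B (1 - \<nu>) - mat_powr A (1 - \<nu>) ** X ** mat_powr B \<nu>)
      = N (schur (\<lambda>i j. of_real (h i j)) Z)"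
    unfolding powr_A powr_B spectral_sandwich difference_sandwich norm_sandwich[OF U V]
    by (simp add: h_def Z_def)
  \<comment> \<open>The one-sided products fit the two-sided formula with the identity as \<open>0\<close>-th power.\<close>
  have one: "rdiag (\<lambda>_. 1) = mat 1"
    by (simp add: rdiag_def mat_def vec_eq_iff)
  have id: "mat 1 = U ** rdiag (\<lambda>_. 1) ** cadjoint U" "mat 1 = V ** rdiag (\<lambda>_. 1) ** cadjoint V"
    using U V by (simp_all add: one unitary_mat_def)
  have "mat_powr A \<alpha> ** X - X ** mat_powr B \<alpha>
      = mat_powr A \<alpha> ** X ** mat 1 - mat 1 ** X ** mat_powr B \<alpha>" by simp
  also have "N \<dots> = N (schur (\<lambda>i j. of_real (k i j)) Z)"
    unfolding powr_A powr_B by (subst id(1), subst id(2))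
      (simp only: spectral_sandwich difference_sandwich norm_sandwich[OF U V], simp add: k_def Z_def)
  finally have rhs: "N (mat_powr A \<alpha> ** X - X ** mat_powr B \<alpha>) = N (schur (\<lambda>i j. of_real (k i j)) Z)" .

  have am: "a i powr (1 - \<alpha>) \<le> m" for i
    using eigenvalue_le_opnorm[OF U, of "\<lambda>i. a i powr (1 - \<alpha>)" i] by (simp add: m_def powr_A)
  have bm: "b j powr (1 - \<alpha>) \<le> m" for j
    using eigenvalue_le_opnorm[OF V, of "\<lambda>i. b i powr (1 - \<alpha>)" j] by (simp add: m_def powr_B)
  have m: "0 < m" by (rule less_le_trans[OF _ am[of undefined]]) (simp add: a less_imp_neq[OF a, symmetric])
  \<comment> \<open>Each of the two diagonal factors is normalised by \<open>sqrt m\<close>, so together they absorb \<open>m\<close>.\<close>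
  have half: "\<bar>x powr ((1 - \<alpha>) / 2) / sqrt m\<bar> \<le> 1" if "0 < x" "x powr (1 - \<alpha>) \<le> m" for x
  proof -
    have "x powr ((1 - \<alpha>) / 2) = sqrt (x powr (1 - \<alpha>))"
      using that(1) by (simp add: powr_half_sqrt_powr)
    then show ?thesis using that m by simp
  qed
  have "schur_contractive N (\<lambda>i j. of_real (c i * d j))"
    unfolding c_def d_def by (intro schur_contractive_diagonal half a b am bm)
  moreover have "schur_contractive N (\<lambda>i j. of_real (g i j))"
    unfolding g_def using assms(3-5) False by (intro schur_contractive_sinh_ratio) auto
  ultimately have contr: "schur_contractive N (\<lambda>i j. of_real (c i * d j) * of_real (g i j))"
    by (rule schur_contractive_mult)

  have "\<alpha> * h i j = (2 * \<nu> - 1) * m * (c i * d j * g i j * k i j)" for i j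
  proof -
    have "a i powr ((1 - \<alpha>) / 2) * b j powr ((1 - \<alpha>) / 2) = m * (c i * d j)"
      using m by (simp add: c_def d_def)
    then show ?thesis
      using heinz_difference_factorization[OF a[of i] b[of j] _ False, of \<alpha>] assms(3)
      by (simp add: h_def g_def k_def)
  qed
  then have factor: "of_real \<alpha> * of_real (h i j) = complex_of_real ((2 * \<nu> - 1) * m) *
      ((of_real (c i * d j) * of_real (g i j)) * of_real (k i j))" for i j
    by (simp only: flip: of_real_mult)
  have "\<alpha> * N (schur (\<lambda>i j. of_real (h i j)) Z)
      = N (schur (\<lambda>i j. of_real \<alpha> * of_real (h i j)) Z)"
    using assms(3) by (simp only: norm_schur_scale norm_of_real)
  also have "\<dots> = \<bar>2 * \<nu> - 1\<bar> * m *
      N (schur (\<lambda>i j. of_real (c i * d j) * of_real (g i j)) (schur (\<lambda>i j. of_real (k i j)) Z))"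
    using m by (simp only: factor norm_schur_scale norm_of_real schur_schur abs_mult)
  also have "\<dots> \<le> \<bar>2 * \<nu> - 1\<bar> * m * N (schur (\<lambda>i j. of_real (k i j)) Z)"
    using contr m by (intro mult_left_mono) (auto simp: schur_contractive_def)
  finally show ?thesis unfolding lhs rhs m_def .
qed

end
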